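(* At the Nash equilibrium of the load-side Cournot game with virtual bidders, with loads $\mathcal L=\{1,\dots,L\}$, $L\ge1$, and virtual bidders $\mathcal V=\{1,\dots,V\}$, the total day-ahead load and the total real-time load are respectively $$d^{DA*}=\sum_{l\in\mathcal L}d_l^{DA*}+\sum_{v\in\mathcal V}d_v^{DA*}=\left(1-\frac{\alpha^{DA}}{(L+V+1)\alpha^{RT}}\right)\sum_{l\in\mathcal L}d_l,$$ $$d^{RT*}=\sum_{l\in\mathcal L}d_l^{RT*}+\sum_{v\in\mathcal V}d_v^{RT*}=\frac{\alpha^{DA}}{(L+V+1)\alpha^{RT}}\sum_{l\in\mathcal L}d_l,$$ which implies $d>d^{DA*}>\frac{L+V}{L+V+1}d$ and $\frac{1}{L+V+1}d>d^{RT*}>0$, where $d=\sum_{l\in\mathcal L}d_l$. As the number of virtual bidders $V$ goes to infinity (with all other data fixed), the total day-ahead load $d^{DA*}$ converges to the total load $d$ and the equilibrium spread $\lambda^{DA}-\lambda^{RT}$ converges to zero.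
   Context: Let $\mathcal F$ (fast-responsive generators) and $\mathcal S$ (slow-responsive generators) be nonempty finite sets, with cost coefficients $\alpha_i^f>0,\ \beta_i^f\in\mathbb R$ for $i\in\mathcal F$ and $\alpha_j^s>0,\ \beta_j^s\in\mathbb R$ for $j\in\mathcal S$ (quadratic costs $\frac{\alpha}{2}x^2+\beta x$). Define $$\alpha^{DA}=\Big(\sum_{i\in\mathcal F}\tfrac1{\alpha_i^f}+\sum_{j\in\mathcal S}\tfrac1{\alpha_j^s}\Big)^{-1},\quad \beta^{DA}=\alpha^{DA}\Big(\sum_{i\in\mathcal F}\tfrac{\beta_i^f}{\alpha_i^f}+\sum_{j\in\mathcal S}\tfrac{\beta_j^s}{\alpha_j^s}\Big),\quad \alpha^{RT}=\Big(\sum_{i\in\mathcal F}\tfrac1{\alpha_i^f}\Big)^{-1}.$$ In particular $\alpha^{RT}>\alpha^{DA}>0$. (Generator nonnegativity constraints are assumed throughout not to be binding, so the price formulas below hold.) Load-side Cournot game with virtual bidders. The players are the loads $l\in\mathcal L$ together with the virtual bidders $v\in\mathcal V$ (the two index sets being regarded as disjoint). Load $l\in\mathcal L$ has inelastic demand $d_l\ge 0$, with $d=\sum_{l\in\mathcal L}d_l>0$; each virtual bidder acts as a load with zero demand, $d_v=0$ for $v\in\mathcal V$. A strategy of player $p\in\mathcal L\cup\mathcal V$ is a pair $\vec d_p=(d_p^{DA},d_p^{RT})$ of real numbers with $d_p^{DA}\ge 0$ and $d_p^{DA}+d_p^{RT}=d_p$ (so $d_p^{RT}$ may have any sign). Given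 a strategy profile $\vec d$, put $d^{DA}=\sum_{p\in\mathcal L\cup\mathcal V}d_p^{DA}$, $d^{RT}=\sum_{p\in\mathcal L\cup\mathcal V}d_p^{RT}$; the day-ahead and real-time prices are $$\lambda^{DA}(\vec d)=\alpha^{DA}d^{DA}+\beta^{DA},\qquad \lambda^{RT}(\vec d)=\alpha^{RT}d^{RT}+\lambda^{DA}(\vec d).$$ The cost of player $p$ is $c_p(\vec d_p;\vec d_{-p})=\lambda^{DA}(\vec d)\,d_p^{DA}+\lambda^{RT}(\vec d)\,d_p^{RT}$, where $\vec d_{-p}$ denotes the strategies of all other players. A profile $\vec d^*$ of strategies is a Nash equilibrium if $c_p(\vec d^*_p;\vec d^*_{-p})\le c_p(\vec d_p;\vec d^*_{-p})$ for every strategy $\vec d_p$ of player $p$ and every player $p$. The game has a unique Nash equilibrium; it is the one referred to in the claim. *)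

theory Defs
  imports Complex_Main "HOL-Library.FuncSet"
begin

definition alpha_DA :: "'f set \<Rightarrow> ('f \<Rightarrow> real) \<Rightarrow> 's set \<Rightarrow> ('s \<Rightarrow> real) \<Rightarrow> real" where
  "alpha_DA F \<alpha>f S \<alpha>s = inverse ((\<Sum>i\<in>F. 1 / \<alpha>f i) + (\<Sum>j\<in>S. 1 / \<alpha>s j))"

definition beta_DA ::
  "'f set \<Rightarrow> ('f \<Rightarrow> real) \<Rightarrow> ('f \<Rightarrow> real) \<Rightarrow> 's set \<Rightarrow> ('s \<Rightarrow> real) \<Rightarrow> ('s \<Rightarrow> real) \<Rightarrow> real" where
  "beta_DA F \<alpha>f \<beta>f S \<alpha>s \<beta>s =
     alpha_DA F \<alpha>f S \<alpha>s * ((\<Sum>i\<in>F. \<beta>f i / \<alpha>f i) + (\<Sum>j\<in>S. \<beta>s j / \<alpha>s j))"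

definition alpha_RT :: "'f set \<Rightarrow> ('f \<Rightarrow> real) \<Rightarrow> real" where
  "alpha_RT F \<alpha>f = inverse (\<Sum>i\<in>F. 1 / \<alpha>f i)"

datatype player = Load nat | Bidder nat

definition players :: "nat \<Rightarrow> nat \<Rightarrow> player set" where
  "players L V = Load ` {1..L} \<union> Bidder ` {1..V}"

fun demand :: "(nat \<Rightarrow> real) \<Rightarrow> player \<Rightarrow> real" where
  "demand d (Load l) = d l"
| "demand d (Bidder v) = 0"

text \<open>A strategy is the pair of the day-ahead and the real-time quantity.\<close>

type_synonym strategy = "real \<times> real"

type_synonym profile = "player \<Rightarrow> strategy"

definition strategies :: "(nat \<Rightarrow> real) \<Rightarrow> player \<Rightarrow> strategy set" where
  "strategies d p = {(x, y). 0 \<le> x \<and> x + y = demand d p}"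

text \<open>Profiles are extensional, i.e. \<^const>\<open>undefined\<close> outside the set of players, so that
  equality of profiles means equality of the strategies of all players.\<close>

definition profiles :: "nat \<Rightarrow> nat \<Rightarrow> (nat \<Rightarrow> real) \<Rightarrow> profile set" where
  "profiles L V d = (\<Pi>\<^sub>E p\<in>players L V. strategies d p)"

definition total_DA :: "nat \<Rightarrow> nat \<Rightarrow> profile \<Rightarrow> real" where
  "total_DA L V x = (\<Sum>p\<in>players L V. fst (x p))"

definition total_RT :: "nat \<Rightarrow> nat \<Rightarrow> profile \<Rightarrow> real" where
  "total_RT L V x = (\<Sum>p\<in>players L V. snd (x p))"

definition price_DA :: "real \<Rightarrow> real \<Rightarrow> nat \<Rightarrow> nat \<Rightarrow> profile \<Rightarrow> real" where
  "price_DA aDA bDA L V x = aDA * total_DA L V x + bDA"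

definition price_RT :: "real \<Rightarrow> real \<Rightarrow> real \<Rightarrow> nat \<Rightarrow> nat \<Rightarrow> profile \<Rightarrow> real" where
  "price_RT aDA bDA aRT L V x = aRT * total_RT L V x + price_DA aDA bDA L V x"

definition cost :: "real \<Rightarrow> real \<Rightarrow> real \<Rightarrow> nat \<Rightarrow> nat \<Rightarrow> player \<Rightarrow> profile \<Rightarrow> real" where
  "cost aDA bDA aRT L V p x =
     price_DA aDA bDA L V x * fst (x p) + price_RT aDA bDA aRT L V x * snd (x p)"

definition nash_equilibrium ::
  "real \<Rightarrow> real \<Rightarrow> real \<Rightarrow> nat \<Rightarrow> nat \<Rightarrow> (nat \<Rightarrow> real) \<Rightarrow> profile \<Rightarrow> bool" where
  "nash_equilibrium aDA bDA aRT L V d x \<longleftrightarrow>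
     x \<in> profiles L V d \<and>
     (\<forall>p\<in>players L V. \<forall>s\<in>strategies d p.
        cost aDA bDA aRT L V p x \<le> cost aDA bDA aRT L V p (x(p := s)))"

end

theory Submission
  imports Defs
begin

text \<open>
  Let $D$ be the total day-ahead load. If player $p$ shifts $t$ from real time to day ahead, its
  cost changes by $t g_p + \alpha^{RT} t^2$, where
  $g_p = \alpha^{DA} d_p - \alpha^{RT} (d_p - d_p^{DA}) - \alpha^{RT} (d - D)$. So equilibrium
  means $g_p \ge 0$ and $d_p^{DA} g_p = 0$ for all $p$. If $D \ge d$ held, the latter would give
  $d_p^{DA} \le (1 - \alpha^{DA}/\alpha^{RT}) d_p$ for all $p$, and summing yields $D < d$. Hence
  $D < d$, which makes $d_p^{DA}$ positive and $g_p$ zero. This is a linear system; summing it over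
  the players determines $D$.
\<close>

section \<open>Sums over the players and the order of the price slopes\<close>

lemma finite_players [simp]: "finite (players L V)"
  by (simp add: players_def)

lemma card_players: "card (players L V) = L + V"
proof -
  have "card (Load ` {1..L}) = L" "card (Bidder ` {1..V}) = V"
    by (subst card_image; simp add: inj_on_def)+
  moreover have "Load ` {1..L} \<inter> Bidder ` {1..V} = {}"
    by auto
  ultimately show ?thesis
    unfolding players_def by (subst card_Un_disjoint) auto
qed

lemma sum_players:
  fixes h :: "player \<Rightarrow> real"
  shows "(\<Sum>p\<in>players L V. h p) = (\<Sum>l=1..L. h (Load l)) + (\<Sum>v=1..V. h (Bidder v))"
proof -
  have "Load ` {1..L} \<inter> Bidder ` {1..V} = {}"
    by auto
  then show ?thesis
    unfolding players_def
    by (subst sum.union_disjoint) (auto simp: sum.reindex inj_on_def)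
qed

lemma sum_demand: "(\<Sum>p\<in>players L V. demand dem p) = (\<Sum>l=1..L. dem l)"
  by (simp add: sum_players)

text \<open>The slow generators add a positive amount to the sum of reciprocals, strictly because
  \<open>S \<noteq> {}\<close>, and inversion reverses the order.\<close>

lemma alpha_bounds:
  assumes "finite F" "F \<noteq> {}" "finite S" "S \<noteq> {}"
    and "\<And>i. i \<in> F \<Longrightarrow> \<alpha>f i > 0" "\<And>j. j \<in> S \<Longrightarrow> \<alpha>s j > 0"
  shows "0 < alpha_DA F \<alpha>f S \<alpha>s" "alpha_DA F \<alpha>f S \<alpha>s < alpha_RT F \<alpha>f"
proof -
  have "(\<Sum>i\<in>F. 1 / \<alpha>f i) > 0" "(\<Sum>j\<in>S. 1 / \<alpha>s j) > 0"
    using assms by (simp_all add: sum_pos)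
  then show "0 < alpha_DA F \<alpha>f S \<alpha>s" "alpha_DA F \<alpha>f S \<alpha>s < alpha_RT F \<alpha>f"
    by (simp_all add: alpha_DA_def alpha_RT_def less_imp_inverse_less)
qed

section \<open>Optimality of a single player's strategy\<close>

text \<open>First-order condition for a convex parabola through the origin on the half-line from
  \<open>-x\<close>: the slope \<open>g\<close> at 0 cannot be negative, and it must vanish when 0
  is interior, that is, when \<open>x > 0\<close>.\<close>

lemma quadratic_minimal_iff:
  fixes r g x :: real
  assumes "r > 0" "x \<ge> 0"
  shows "(\<forall>t\<ge>-x. 0 \<le> t * g + r * t\<^sup>2) \<longleftrightarrow> 0 \<le> g \<and> x * g = 0"
proof
  assume *: "\<forall>t\<ge>-x. 0 \<le> t * g + r * t\<^sup>2"
  have "g \<ge> 0"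
  proof (rule ccontr)
    assume "\<not> g \<ge> 0"
    \<comment> \<open>The vertex of the parabola; it is feasible because it is positive, and the
      value there is negative.\<close>
    then have t: "- g / (2 * r) > 0"
      using assms by (simp add: field_simps)
    then have "0 \<le> (- g / (2 * r)) * g + r * (- g / (2 * r))\<^sup>2"
      using assms by (intro *[rule_format]) linarith
    also have "\<dots> = - (g\<^sup>2 / (4 * r))"
      using assms by (simp add: field_simps power2_eq_square)
    also have "\<dots> < 0"
      using assms \<open>\<not> g \<ge> 0\<close> by simp
    finally show False
      by simp
  qed
  moreover have "x = 0" if "g > 0"
  proof (rule ccontr)
    assume "x \<noteq> 0"
    \<comment> \<open>A step to the left by \<open>m\<close>: the bound \<open>x\<close> keeps it
      feasible, and the bound \<open>g / (2 * r)\<close> lets the linear gain outweigh the quadratic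
      loss.\<close>
    define m where "m = min x (g / (2 * r))"
    have m: "m > 0" "m \<le> x" "m \<le> g / (2 * r)"
      using assms \<open>x \<noteq> 0\<close> that by (auto simp: m_def)
    then have "r * m < g"
      using assms that by (simp add: field_simps)
    then have "m * (r * m - g) < 0"
      using m by (simp add: mult_pos_neg)
    moreover have "0 \<le> (- m) * g + r * (- m)\<^sup>2"
      using *[rule_format, of "- m"] m by simp
    ultimately show False
      by (simp add: algebra_simps power2_eq_square)
  qed
  ultimately show "0 \<le> g \<and> x * g = 0"
    by force
next
  assume *: "0 \<le> g \<and> x * g = 0"
  show "\<forall>t\<ge>-x. 0 \<le> t * g + r * t\<^sup>2"
  proof (intro allI impI)
    fix t assume "- x \<le> t"
    then have "- x * g \<le> t * g"
      using * by (intro mult_right_mono) auto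
    then show "0 \<le> t * g + r * t\<^sup>2"
      using * assms by simp
  qed
qed

text \<open>The derivative \<open>g_p\<close> at \<open>t = 0\<close>, with \<open>d - D\<close>
  written as the total real-time load. The price intercept is absent because it is paid on the fixed
  demand \<open>demand dem p\<close>.\<close>

definition marginal_cost ::
  "real \<Rightarrow> real \<Rightarrow> nat \<Rightarrow> nat \<Rightarrow> (nat \<Rightarrow> real) \<Rightarrow> profile \<Rightarrow> player \<Rightarrow> real" where
  "marginal_cost a r L V dem x p =
     a * demand dem p - r * (demand dem p - fst (x p)) - r * total_RT L V x"

lemma profile_strategy:
  assumes "x \<in> profiles L V dem" "p \<in> players L V"
  shows "0 \<le> fst (x p)" "snd (x p) = demand dem p - fst (x p)"
  using PiE_mem[OF assms[unfolded profiles_def]] by (auto simp: strategies_def)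

lemma total_RT_eq:
  assumes "x \<in> profiles L V dem"
  shows "total_RT L V x = (\<Sum>l=1..L. dem l) - total_DA L V x"
  unfolding sum_demand[symmetric, of dem L V] total_RT_def total_DA_def
  using profile_strategy(2)[OF assms] by (simp flip: sum_subtractf)

text \<open>As the two quantities of \<open>p\<close> add up to its demand, its cost is the
  day-ahead price times that demand plus \<open>r * total_RT L V x * snd (x p)\<close>. The shift
  lowers both factors of the last product by \<open>t\<close>, whence the term
  \<open>r * t\<^sup>2\<close>.\<close>

lemma cost_deviation:
  assumes x: "x \<in> profiles L V dem" and p: "p \<in> players L V"
  shows "cost a b r L V p (x(p := (fst (x p) + t, snd (x p) - t))) - cost a b r L V p x
       = t * marginal_cost a r L V dem x p + r * t\<^sup>2"
proof -
  let ?y = "x(p := (fst (x p) + t, snd (x p) - t))"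
  have DA: "total_DA L V ?y = total_DA L V x + t" and RT: "total_RT L V ?y = total_RT L V x - t"
    by (simp_all add: total_DA_def total_RT_def sum.remove[OF finite_players p])
  show ?thesis
    unfolding cost_def price_DA_def price_RT_def DA RT marginal_cost_def
    unfolding fun_upd_same fst_conv snd_conv profile_strategy(2)[OF x p]
    by (simp add: algebra_simps power2_eq_square)
qed

lemma nash_equilibrium_iff_marginal:
  assumes "r > 0"
  shows "nash_equilibrium a b r L V dem x \<longleftrightarrow>
    x \<in> profiles L V dem \<and>
    (\<forall>p\<in>players L V. 0 \<le> marginal_cost a r L V dem x p \<and>
       fst (x p) * marginal_cost a r L V dem x p = 0)"
proof -
  have "(\<forall>s\<in>strategies dem p. cost a b r L V p x \<le> cost a b r L V p (x(p := s))) \<longleftrightarrow>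
        0 \<le> marginal_cost a r L V dem x p \<and> fst (x p) * marginal_cost a r L V dem x p = 0"
    if x: "x \<in> profiles L V dem" and p: "p \<in> players L V" for p
  proof -
    note xp = profile_strategy[OF x p]
    \<comment> \<open>The sum constraint leaves one degree of freedom, so every deviation is a shift
      by some \<open>t\<close>, and \<open>- fst (x p) \<le> t\<close> is nonnegativity of the
      day-ahead quantity.\<close>
    have shifts: "strategies dem p = (\<lambda>t. (fst (x p) + t, snd (x p) - t)) ` {- fst (x p)..}"
    proof (intro equalityI subsetI)
      fix s assume "s \<in> strategies dem p"
      then show "s \<in> (\<lambda>t. (fst (x p) + t, snd (x p) - t)) ` {- fst (x p)..}"
        by (intro image_eqI[where x = "fst s - fst (x p)"]) (auto simp: strategies_def xp)
    qed (auto simp: strategies_def xp)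
    have dev: "cost a b r L V p x \<le> cost a b r L V p (x(p := (fst (x p) + t, snd (x p) - t))) \<longleftrightarrow>
        0 \<le> t * marginal_cost a r L V dem x p + r * t\<^sup>2" for t
      using cost_deviation[OF x p, of a b r t] by linarith
    have "(\<forall>s\<in>strategies dem p. cost a b r L V p x \<le> cost a b r L V p (x(p := s))) \<longleftrightarrow>
      (\<forall>t\<ge>- fst (x p). 0 \<le> t * marginal_cost a r L V dem x p + r * t\<^sup>2)"
      by (simp only: shifts ball_simps dev) (simp only: Ball_def atLeast_iff)
    then show ?thesis
      using quadratic_minimal_iff[OF assms xp(1)] by simp
  qed
  then show ?thesis
    unfolding nash_equilibrium_def by blast
qed

section \<open>The equilibrium in closed form\<close>

definition equilibrium_RT :: "real \<Rightarrow> real \<Rightarrow> nat \<Rightarrow> nat \<Rightarrow> (nat \<Rightarrow> real) \<Rightarrow> real" where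
  "equilibrium_RT a r L V dem = a / (real (L + V + 1) * r) * (\<Sum>l=1..L. dem l)"

text \<open>The day-ahead quantity at which the marginal cost vanishes when the total real-time load
  is \<open>equilibrium_RT\<close>.\<close>

definition equilibrium_DA ::
  "real \<Rightarrow> real \<Rightarrow> nat \<Rightarrow> nat \<Rightarrow> (nat \<Rightarrow> real) \<Rightarrow> player \<Rightarrow> real" where
  "equilibrium_DA a r L V dem p = (1 - a / r) * demand dem p + equilibrium_RT a r L V dem"

text \<open>Kept general in \<open>\<rho>\<close>: it is applied both to the still unknown total
  real-time load of an equilibrium and to \<open>equilibrium_RT\<close>.\<close>

lemma sum_best_response:
  fixes a r \<rho> :: real
  shows "(\<Sum>p\<in>players L V. (1 - a / r) * demand dem p + \<rho>)
       = (1 - a / r) * (\<Sum>l=1..L. dem l) + real (L + V) * \<rho>"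
  by (simp add: sum.distrib card_players sum_demand flip: sum_distrib_left)

context
  fixes L :: nat and dem :: "nat \<Rightarrow> real" and a r :: real
  assumes a_pos: "0 < a" and a_less: "a < r"
    and dem_nonneg: "\<forall>l\<in>{1..L}. dem l \<ge> 0"
    and dem_pos: "(\<Sum>l=1..L. dem l) > 0"
begin

lemma demand_nonneg: "p \<in> players L V \<Longrightarrow> 0 \<le> demand dem p"
  using dem_nonneg by (auto simp: players_def)

lemma equilibrium_RT_pos: "equilibrium_RT a r L V dem > 0"
  using a_pos a_less dem_pos by (simp add: equilibrium_RT_def)

lemma equilibrium_RT_less:
  "equilibrium_RT a r L V dem < 1 / real (L + V + 1) * (\<Sum>l=1..L. dem l)"
proof -
  have "a / (real (L + V + 1) * r) < 1 / real (L + V + 1)"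
    using a_pos a_less by (simp add: divide_simps)
  then show ?thesis
    unfolding equilibrium_RT_def using dem_pos by (rule mult_strict_right_mono)
qed

text \<open>Write \<open>d\<close> for the total demand and \<open>\<rho>\<close> for
  \<open>equilibrium_RT\<close>. This is a rearrangement of
  \<open>d - \<rho> = (1 - a / r) * d + (L + V) * \<rho>\<close>, the sum over the players of the
  equations "marginal cost is zero".\<close>

lemma equilibrium_RT_fixpoint:
  "real (L + V + 1) * equilibrium_RT a r L V dem = a / r * (\<Sum>l=1..L. dem l)"
  using a_pos a_less by (simp add: equilibrium_RT_def)

lemma marginal_cost_altdef:
  "marginal_cost a r L V dem x p
     = r * (fst (x p) - ((1 - a / r) * demand dem p + total_RT L V x))"
  using a_pos a_less by (simp add: marginal_cost_def field_simps)

text \<open>Ensures that the constraint of nonnegative day-ahead quantities does not bind at an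
  equilibrium, so that the conditions become linear equations.\<close>

lemma nash_total_RT_pos:
  assumes "nash_equilibrium a b r L V dem x"
  shows "total_RT L V x > 0"
proof (rule ccontr)
  assume neg: "\<not> total_RT L V x > 0"
  have r: "r > 0"
    using a_pos a_less by simp
  have x: "x \<in> profiles L V dem"
    and slack: "\<And>p. p \<in> players L V \<Longrightarrow> fst (x p) * marginal_cost a r L V dem x p = 0"
    using assms nash_equilibrium_iff_marginal[OF r] by auto
  have "fst (x p) \<le> (1 - a / r) * demand dem p" if "p \<in> players L V" for p
  proof (cases "fst (x p) = 0")
    case True
    then show ?thesis
      using r a_less demand_nonneg[OF that] by simp
  next
    case False
    then show ?thesis
      using slack[OF that] neg r by (simp add: marginal_cost_altdef)
  qed
  then have "total_DA L V x \<le> (\<Sum>p\<in>players L V. (1 - a / r) * demand dem p)"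
    unfolding total_DA_def by (rule sum_mono)
  also have "\<dots> = (1 - a / r) * (\<Sum>l=1..L. dem l)"
    by (simp add: sum_demand flip: sum_distrib_left)
  also have "\<dots> < 1 * (\<Sum>l=1..L. dem l)"
    using a_pos r dem_pos by (intro mult_strict_right_mono) auto
  finally show False
    using neg total_RT_eq[OF x] by simp
qed

text \<open>Being equivalent to equality with one explicit profile, the equilibrium condition has
  exactly one solution. The restricted lambda matches the extensionality of profiles.\<close>

lemma nash_equilibrium_iff:
  "nash_equilibrium a b r L V dem x \<longleftrightarrow>
     x = (\<lambda>p\<in>players L V.
            (equilibrium_DA a r L V dem p, demand dem p - equilibrium_DA a r L V dem p))"
  (is "_ \<longleftrightarrow> x = ?e")
proof
  have r: "r > 0"
    using a_pos a_less by simp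
  have DA_nonneg: "0 \<le> equilibrium_DA a r L V dem p" if "p \<in> players L V" for p
    using r a_less demand_nonneg[OF that] equilibrium_RT_pos[of V]
    by (simp add: equilibrium_DA_def)
  {
    assume nash: "nash_equilibrium a b r L V dem x"
    then have x: "x \<in> profiles L V dem"
      and slack: "\<And>p. p \<in> players L V \<Longrightarrow> 0 \<le> marginal_cost a r L V dem x p \<and>
        fst (x p) * marginal_cost a r L V dem x p = 0"
      using nash_equilibrium_iff_marginal[OF r] by auto
    \<comment> \<open>Nonnegative marginal cost bounds \<open>fst (x p)\<close> below by the
      right-hand side, which is positive; complementary slackness then forces equality.\<close>
    have eq: "fst (x p) = (1 - a / r) * demand dem p + total_RT L V x"
      if "p \<in> players L V" for p
    proof -
      have "0 \<le> fst (x p) - ((1 - a / r) * demand dem p + total_RT L V x)"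
        using slack[OF that] r by (simp add: marginal_cost_altdef zero_le_mult_iff)
      moreover have "0 \<le> (1 - a / r) * demand dem p"
        using r a_less demand_nonneg[OF that] by simp
      ultimately have "fst (x p) > 0"
        using nash_total_RT_pos[OF nash] by linarith
      then show ?thesis
        using slack[OF that] r by (simp add: marginal_cost_altdef)
    qed
    have "total_DA L V x = (1 - a / r) * (\<Sum>l=1..L. dem l) + real (L + V) * total_RT L V x"
      unfolding total_DA_def using eq by (simp add: sum_best_response)
    moreover have "(1 - a / r) * (\<Sum>l=1..L. dem l)
        = (\<Sum>l=1..L. dem l) - real (L + V + 1) * equilibrium_RT a r L V dem"
      unfolding equilibrium_RT_fixpoint by (simp add: left_diff_distrib)
    ultimately have "real (L + V + 1) * total_RT L V x
        = real (L + V + 1) * equilibrium_RT a r L V dem"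
      using total_RT_eq[OF x] by (simp add: distrib_right)
    then have RT: "total_RT L V x = equilibrium_RT a r L V dem"
      by (subst (asm) mult_cancel_left) simp
    show "x = ?e"
    proof
      fix p
      show "x p = ?e p"
      proof (cases "p \<in> players L V")
        case True
        then show ?thesis
          using eq[OF True] profile_strategy(2)[OF x True]
          by (simp add: prod_eq_iff equilibrium_DA_def RT)
      next
        case False
        then show ?thesis
          using PiE_arb[OF x[unfolded profiles_def] False] by simp
      qed
    qed
  next
    assume e: "x = ?e"
    have x: "x \<in> profiles L V dem"
      unfolding e profiles_def using DA_nonneg by (auto simp: strategies_def)
    \<comment> \<open>The explicit profile was built from a presumed total real-time load; its
      actual total has to agree with that value before the marginal costs can be seen to
      vanish.\<close>
    have "total_DA L V x
        = (1 - a / r) * (\<Sum>l=1..L. dem l) + real (L + V) * equilibrium_RT a r L V dem"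
      by (simp add: total_DA_def e equilibrium_DA_def sum_best_response)
    then have RT: "total_RT L V x = equilibrium_RT a r L V dem"
      using total_RT_eq[OF x] equilibrium_RT_fixpoint[of V] by (simp add: algebra_simps)
    have "marginal_cost a r L V dem x p = 0" if "p \<in> players L V" for p
      using that unfolding marginal_cost_altdef RT by (simp add: e equilibrium_DA_def)
    then show "nash_equilibrium a b r L V dem x"
      using x by (simp add: nash_equilibrium_iff_marginal[OF r])
  }
qed

section \<open>Equilibrium totals and the limit of many virtual bidders\<close>

lemma nash_total_RT:
  assumes "nash_equilibrium a b r L V dem x"
  shows "total_RT L V x = equilibrium_RT a r L V dem"
proof -
  have "total_RT L V x = (\<Sum>p\<in>players L V. demand dem p)
      - (\<Sum>p\<in>players L V. (1 - a / r) * demand dem p + equilibrium_RT a r L V dem)"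
    using assms[unfolded nash_equilibrium_iff]
    by (simp add: total_RT_def equilibrium_DA_def flip: sum_subtractf)
  also have "\<dots> = equilibrium_RT a r L V dem"
    using equilibrium_RT_fixpoint[of V]
    by (simp only: sum_best_response sum_demand) (simp add: algebra_simps)
  finally show ?thesis .
qed

lemma nash_total_DA:
  assumes "nash_equilibrium a b r L V dem x"
  shows "total_DA L V x = (\<Sum>l=1..L. dem l) - equilibrium_RT a r L V dem"
proof -
  have "x \<in> profiles L V dem"
    using assms by (simp add: nash_equilibrium_def)
  from total_RT_eq[OF this] show ?thesis
    using nash_total_RT[OF assms] by simp
qed

lemma equilibrium_RT_tendsto_0: "(\<lambda>V. equilibrium_RT a r L V dem) \<longlonglongrightarrow> 0"
proof (rule tendsto_sandwich)
  show "\<forall>\<^sub>F V in sequentially. 0 \<le> equilibrium_RT a r L V dem"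
    using equilibrium_RT_pos by (simp add: less_imp_le)
  \<comment> \<open>The denominator is arranged as \<open>V + (L + 1)\<close> to exhibit the bound
    as a shift of the sequence \<open>1 / n\<close>, scaled by the total demand.\<close>
  show "\<forall>\<^sub>F V in sequentially.
      equilibrium_RT a r L V dem \<le> 1 / real (V + (L + 1)) * (\<Sum>l=1..L. dem l)"
    using equilibrium_RT_less by (simp add: less_imp_le ac_simps)
  have "(\<lambda>V. 1 / real (V + (L + 1))) \<longlonglongrightarrow> 0"
    by (rule LIMSEQ_ignore_initial_segment[OF lim_1_over_n])
  then show "(\<lambda>V. 1 / real (V + (L + 1)) * (\<Sum>l=1..L. dem l)) \<longlonglongrightarrow> 0"
    by (rule tendsto_mult_left_zero)
qed simp

end

section \<open>Totals, bounds and limits for the given generator data\<close>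

theorem corollary2:
  fixes F :: "'f set" and S :: "'s set"
    and \<alpha>f \<beta>f :: "'f \<Rightarrow> real" and \<alpha>s \<beta>s :: "'s \<Rightarrow> real"
    and L :: nat and dem :: "nat \<Rightarrow> real"
    and aDA bDA aRT d :: real
  assumes "finite F" and "F \<noteq> {}" and "finite S" and "S \<noteq> {}"
    and "\<And>i. i \<in> F \<Longrightarrow> \<alpha>f i > 0" and "\<And>j. j \<in> S \<Longrightarrow> \<alpha>s j > 0"
    and "L \<ge> 1"
    and "\<And>l. l \<in> {1..L} \<Longrightarrow> dem l \<ge> 0"
    and "d = (\<Sum>l=1..L. dem l)" and "d > 0"
    and "aDA = alpha_DA F \<alpha>f S \<alpha>s"
    and "bDA = beta_DA F \<alpha>f \<beta>f S \<alpha>s \<beta>s"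
    and "aRT = alpha_RT F \<alpha>f"
  shows
    "(\<forall>V. \<exists>!x. nash_equilibrium aDA bDA aRT L V dem x) \<and>
     (\<forall>V x. nash_equilibrium aDA bDA aRT L V dem x \<longrightarrow>
        total_DA L V x = (\<Sum>l=1..L. fst (x (Load l))) + (\<Sum>v=1..V. fst (x (Bidder v))) \<and>
        total_DA L V x = (1 - aDA / (real (L + V + 1) * aRT)) * (\<Sum>l=1..L. dem l) \<and>
        total_RT L V x = (\<Sum>l=1..L. snd (x (Load l))) + (\<Sum>v=1..V. snd (x (Bidder v))) \<and>
        total_RT L V x = aDA / (real (L + V + 1) * aRT) * (\<Sum>l=1..L. dem l) \<and>
        d > total_DA L V x \<and>
        total_DA L V x > real (L + V) / real (L + V + 1) * d \<and>
        1 / real (L + V + 1) * d > total_RT L V x \<and>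
        total_RT L V x > 0) \<and>
     (\<forall>x. (\<forall>V. nash_equilibrium aDA bDA aRT L V dem (x V)) \<longrightarrow>
        (\<lambda>V. total_DA L V (x V)) \<longlonglongrightarrow> d \<and>
        (\<lambda>V. price_DA aDA bDA L V (x V) - price_RT aDA bDA aRT L V (x V)) \<longlonglongrightarrow> 0)"
proof (intro conjI allI impI)
  note bounds = alpha_bounds[OF assms(1-6)]
  have a_pos: "0 < aDA" and a_less: "aDA < aRT"
    using bounds by (simp_all add: assms)
  have d_pos: "(\<Sum>l=1..L. dem l) > 0"
    using assms(9,10) by simp
  have dem_nonneg: "\<forall>l\<in>{1..L}. dem l \<ge> 0"
    using assms(8) by blast
  note game = a_pos a_less dem_nonneg d_pos
  show "\<exists>!x. nash_equilibrium aDA bDA aRT L V dem x" for V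
    by (simp add: nash_equilibrium_iff[OF game])
  show "total_DA L V x = (\<Sum>l=1..L. fst (x (Load l))) + (\<Sum>v=1..V. fst (x (Bidder v)))" for V x
    by (simp add: total_DA_def sum_players)
  show "total_RT L V x = (\<Sum>l=1..L. snd (x (Load l))) + (\<Sum>v=1..V. snd (x (Bidder v)))" for V x
    by (simp add: total_RT_def sum_players)
  {
    fix V x
    assume nash: "nash_equilibrium aDA bDA aRT L V dem x"
    note DA = nash_total_DA[OF game nash] and RT = nash_total_RT[OF game nash]
    show "total_DA L V x = (1 - aDA / (real (L + V + 1) * aRT)) * (\<Sum>l=1..L. dem l)"
      unfolding DA equilibrium_RT_def by (simp add: left_diff_distrib)
    show "total_RT L V x = aDA / (real (L + V + 1) * aRT) * (\<Sum>l=1..L. dem l)"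
      unfolding RT equilibrium_RT_def ..
    show RT_pos: "total_RT L V x > 0"
      unfolding RT by (rule equilibrium_RT_pos[OF game])
    then show "d > total_DA L V x"
      by (simp add: assms(9) DA RT)
    show RT_less: "1 / real (L + V + 1) * d > total_RT L V x"
      unfolding RT assms(9) by (rule equilibrium_RT_less[OF game])
    \<comment> \<open>With this identity the lower bound on the day-ahead load is the upper bound on
      the real-time load, subtracted from \<open>d\<close>.\<close>
    have "real (L + V) / real (L + V + 1) * d = d - 1 / real (L + V + 1) * d"
      by (simp add: field_simps)
    then show "total_DA L V x > real (L + V) / real (L + V + 1) * d"
      using RT_less unfolding DA RT assms(9) by linarith
  next
    fix x
    assume "\<forall>V. nash_equilibrium aDA bDA aRT L V dem (x V)"
    then have nash: "nash_equilibrium aDA bDA aRT L V dem (x V)" for V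
      by simp
    note lim = equilibrium_RT_tendsto_0[OF game]
    show "(\<lambda>V. total_DA L V (x V)) \<longlonglongrightarrow> d"
      using tendsto_diff[OF tendsto_const lim, of d]
      by (simp add: nash_total_DA[OF game nash] assms(9))
    \<comment> \<open>The spread equals \<open>- aRT\<close> times the total real-time load, so it
      vanishes with that load.\<close>
    show "(\<lambda>V. price_DA aDA bDA L V (x V) - price_RT aDA bDA aRT L V (x V)) \<longlonglongrightarrow> 0"
      using tendsto_mult_right_zero[OF lim, of "- aRT"]
      by (simp add: price_RT_def nash_total_RT[OF game nash])
  }
qed

end
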